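(* Let $SE(2)=\{\vec v\mapsto A\vec v+\vec b:\ A\in SO(2),\ \vec b\in\mathbb{R}^2\}$ act on $\mathbb{R}^2$, with $2$ colors. Then $\mathrm{ext}_D(\mathbb{R}^2,SE(2))<\infty$.
   Context: Let a group $\Gamma$ act faithfully on a set $X$. A coloring $c:X\to\{R,B\}$ is $\Gamma$-distinguishing if the only $\gamma\in\Gamma$ with $c\circ\gamma=c$ is the identity. For $W\subset X$ whose pointwise stabilizer in $\Gamma$ is trivial, the property $P(W)$ holds if every precoloring $c:X\setminus W\to\{R,B\}$ can be extended to a $\Gamma$-distinguishing coloring $X\to\{R,B\}$. The distinguishing extension number $\mathrm{ext}_D(X,\Gamma)$ is the smallest $m$ such that every $W\subset X$ with $|W|\geq m$ and trivial pointwise stabilizer satisfies $P(W)$ ($\infty$ if none exists). *)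

theory Defs
  imports "HOL-Analysis.Analysis" "HOL-Library.Extended_Nat"
begin

text \<open>A group is represented by a set G of maps X \<Rightarrow> X (acting on X by evaluation).
Colorings use two colors, represented by bool (True = R, False = B).\<close>

definition distinguishing :: "'a set \<Rightarrow> ('a \<Rightarrow> 'a) set \<Rightarrow> ('a \<Rightarrow> bool) \<Rightarrow> bool" where
  "distinguishing X G c \<longleftrightarrow>
     (\<forall>g\<in>G. (\<forall>x\<in>X. c (g x) = c x) \<longrightarrow> (\<forall>x\<in>X. g x = x))"

definition trivial_pointwise_stabilizer :: "'a set \<Rightarrow> ('a \<Rightarrow> 'a) set \<Rightarrow> 'a set \<Rightarrow> bool" where
  "trivial_pointwise_stabilizer X G W \<longleftrightarrow>
     (\<forall>g\<in>G. (\<forall>w\<in>W. g w = w) \<longrightarrow> (\<forall>x\<in>X. g x = x))"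

text \<open>Property P(W): every precoloring of X - W extends to a distinguishing coloring of X.
A precoloring is any function whose values are only relevant on X - W.\<close>
definition prop_P :: "'a set \<Rightarrow> ('a \<Rightarrow> 'a) set \<Rightarrow> 'a set \<Rightarrow> bool" where
  "prop_P X G W \<longleftrightarrow>
     (\<forall>c :: 'a \<Rightarrow> bool. \<exists>c'. (\<forall>x\<in>X - W. c' x = c x) \<and> distinguishing X G c')"

definition card_at_least :: "'a set \<Rightarrow> nat \<Rightarrow> bool" where
  "card_at_least W m \<longleftrightarrow> infinite W \<or> m \<le> card W"

definition ext_D_good :: "'a set \<Rightarrow> ('a \<Rightarrow> 'a) set \<Rightarrow> nat \<Rightarrow> bool" where
  "ext_D_good X G m \<longleftrightarrow>
     (\<forall>W. W \<subseteq> X \<and> card_at_least W m \<and> trivial_pointwise_stabilizer X G W \<longrightarrow> prop_P X G W)"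

definition ext_D :: "'a set \<Rightarrow> ('a \<Rightarrow> 'a) set \<Rightarrow> enat" where
  "ext_D X G = (if \<exists>m. ext_D_good X G m then enat (LEAST m. ext_D_good X G m) else \<infinity>)"

definition SE2 :: "(real^2 \<Rightarrow> real^2) set" where
  "SE2 = {(\<lambda>v. A *v v + b) | A b. rotation_matrix (A :: real^2^2)}"

end

theory Submission
  imports Defs "HOL-Computational_Algebra.Polynomial"
begin

text \<open>
  Identify the plane with the complex numbers, so that rigid motions become maps z \<mapsto> a z + b.

  Suppose first that some translation by \<tau> \<noteq> 0 preserves the colouring up to finitely many points,
  and let f be the 0/1 function of the colouring. Then D(x) = f(x - \<tau>) - f(x) has finite support, and
  summation by parts assigns a value to the formal moment \<open>\<Sum>x. f x * p x\<close>, namely the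
  sum of D q for any polynomial q with q(x + \<tau>) - q(x) = p(x). If the sum of D is 0, this does not
  depend on the choice of q; it is invariant under symmetries of f; and recolouring
  a point w adds p(w). (If the sum of D is not 0, there are no symmetries at all.) A symmetry with
  a \<noteq> 1 forces the second or the third central moment to vanish, according to whether
  \<open>a\<^sup>2 \<noteq> 1\<close> or a = -1. Once the zeroth moment avoids 0, 1, 2, these are nontrivial polynomial
  conditions, of degrees 2 and 3, on the last recoloured point, so one of six candidates violates
  both. At most three further points adjust the zeroth moment, so nine points suffice.

  Otherwise take a symmetry of the colouring, recolour a point w that it does not fix, and take a
  symmetry of the new colouring. Their commutator is a translation preserving the colouring up to
  finitely many points, hence trivial; but commuting symmetries give contradictory colours to an
  image of w.
\<close>

section \<open>Finite differences and their pairing with polynomials\<close>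

definition pairing :: "(complex \<Rightarrow> complex) \<Rightarrow> complex poly \<Rightarrow> complex" where
  "pairing h q = (\<Sum>x | h x \<noteq> 0. h x * poly q x)"

definition fin_supp :: "(complex \<Rightarrow> complex) \<Rightarrow> bool" where
  "fin_supp h \<longleftrightarrow> finite {x. h x \<noteq> 0}"

text \<open>The shift runs backwards so that \<open>back_diff\<close> becomes the adjoint of
  \<open>poly_diff\<close> under \<open>pairing\<close>.\<close>

definition back_diff :: "complex \<Rightarrow> (complex \<Rightarrow> complex) \<Rightarrow> complex \<Rightarrow> complex" where
  "back_diff \<tau> f x = f (x - \<tau>) - f x"

definition poly_diff :: "complex \<Rightarrow> complex poly \<Rightarrow> complex poly" where
  "poly_diff \<tau> q = pcompose q [:\<tau>, 1:] - q"

lemma poly_poly_diff [simp]: "poly (poly_diff \<tau> q) x = poly q (x + \<tau>) - poly q x"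
  by (simp add: poly_diff_def poly_pcompose add.commute)

lemma poly_diff_linear [simp]:
  "poly_diff \<tau> (p + q) = poly_diff \<tau> p + poly_diff \<tau> q"
  "poly_diff \<tau> (p - q) = poly_diff \<tau> p - poly_diff \<tau> q"
  "poly_diff \<tau> (smult a p) = smult a (poly_diff \<tau> p)"
  by (simp_all add: poly_diff_def pcompose_add pcompose_diff pcompose_smult smult_diff_right)

text \<open>The difference of \<open>X^(n+1)\<close> has leading term
  \<open>(n+1) * \<tau> * X^n\<close>, so a multiple of it cancels the top coefficient of
  \<open>p\<close>; induct on a bound for the degree.\<close>

lemma poly_diff_surj:
  assumes "\<tau> \<noteq> 0"
  obtains q where "poly_diff \<tau> q = p"
proof -
  have "\<exists>q. poly_diff \<tau> q = p" if "\<And>i. i \<ge> n \<Longrightarrow> coeff p i = 0" for n p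
    using that
  proof (induction n arbitrary: p)
    case 0
    then have "p = 0" by (simp add: poly_eq_iff)
    then show ?case by (intro exI[of _ 0]) (simp add: poly_diff_def)
  next
    case (Suc n)
    define q0 where "q0 = smult (coeff p n / (of_nat (Suc n) * \<tau>)) (monom 1 (Suc n))"
    have "pcompose (monom 1 (Suc n)) [:\<tau>, 1:] = [:\<tau>, 1:] ^ Suc n"
      by (intro poly_ext) (simp add: poly_pcompose poly_monom poly_power algebra_simps)
    then have pd: "poly_diff \<tau> (monom 1 (Suc n)) = [:\<tau>, 1:] ^ Suc n - monom 1 (Suc n)"
      by (simp only: poly_diff_def)
    have c: "coeff (poly_diff \<tau> (monom 1 (Suc n))) i = (if i = n then of_nat (Suc n) * \<tau> else 0)"
      if i: "i \<ge> n" for i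
    proof -
      consider "i = n" | "i = Suc n" | "i > Suc n" using i by linarith
      then show ?thesis
      proof cases
        case 3
        then have "coeff ([:\<tau>, 1:] ^ Suc n) i = 0"
          by (intro coeff_eq_0) (simp only: degree_linear_power)
        then show ?thesis using 3 by (simp add: pd del: power_Suc)
      qed (simp_all add: pd coeff_linear_poly_power del: power_Suc of_nat_Suc)
    qed
    have "coeff (p - poly_diff \<tau> q0) i = 0" if i: "i \<ge> n" for i
    proof -
      have "(of_nat (Suc n) :: complex) \<noteq> 0" by (simp del: of_nat_Suc)
      then show ?thesis using assms Suc.prems[of i] i
        unfolding q0_def poly_diff_linear coeff_diff coeff_smult c[OF i] by (auto simp del: of_nat_Suc)
    qed
    then obtain q1 where "poly_diff \<tau> q1 = p - poly_diff \<tau> q0"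
      using Suc.IH by blast
    then have "poly_diff \<tau> (q1 + q0) = p" by simp
    then show ?case by blast
  qed
  from this[of "Suc (degree p)" p] show ?thesis
    using that by (meson coeff_eq_0 less_eq_Suc_le)
qed

text \<open>Such a \<open>q\<close> takes the value \<open>poly q 0\<close> at all multiples of
  \<open>\<tau>\<close>, hence infinitely often.\<close>

lemma poly_diff_eq_0:
  assumes "\<tau> \<noteq> 0" "poly_diff \<tau> q = 0"
  obtains k where "q = [:k:]"
proof -
  have step: "poly q (x + \<tau>) = poly q x" for x
    using arg_cong[OF assms(2), of "\<lambda>p. poly p x"] by simp
  have per: "poly q (of_nat n * \<tau>) = poly q 0" for n
  proof (induction n)
    case (Suc n)
    then show ?case using step[of "of_nat n * \<tau>"] by (simp add: algebra_simps)
  qed simp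
  have "range (\<lambda>n. of_nat n * \<tau>) \<subseteq> {x. poly (q - [:poly q 0:]) x = 0}"
    using per by auto
  moreover have "infinite (range (\<lambda>n. of_nat n * \<tau>))"
    using assms(1) by (intro range_inj_infinite) (auto simp: inj_on_def)
  ultimately have "infinite {x. poly (q - [:poly q 0:]) x = 0}"
    using infinite_super by blast
  then have "q - [:poly q 0:] = 0" using poly_roots_finite by blast
  then show ?thesis using that[of "poly q 0"] by simp
qed

lemma pairing_superset:
  assumes "finite B" "\<And>x. h x \<noteq> 0 \<Longrightarrow> x \<in> B"
  shows "pairing h q = (\<Sum>x\<in>B. h x * poly q x)"
  unfolding pairing_def using assms by (intro sum.mono_neutral_left) auto

lemma pairing_right_linear:
  "pairing h (p + q) = pairing h p + pairing h q"
  "pairing h (p - q) = pairing h p - pairing h q"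
  "pairing h (smult a q) = a * pairing h q"
  by (simp_all add: pairing_def algebra_simps sum.distrib sum_subtractf sum_distrib_left)

lemma
  assumes "fin_supp h" "fin_supp k"
  shows fin_supp_add: "fin_supp (\<lambda>x. h x + k x)"
    and fin_supp_diff: "fin_supp (\<lambda>x. h x - k x)"
    and pairing_add_left: "pairing (\<lambda>x. h x + k x) q = pairing h q + pairing k q"
    and pairing_diff_left: "pairing (\<lambda>x. h x - k x) q = pairing h q - pairing k q"
proof -
  let ?B = "{x. h x \<noteq> 0} \<union> {x. k x \<noteq> 0}"
  have fin: "finite ?B" using assms by (simp add: fin_supp_def)
  then show "fin_supp (\<lambda>x. h x + k x)" "fin_supp (\<lambda>x. h x - k x)"
    unfolding fin_supp_def by (force intro: finite_subset[OF _ fin])+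
  show "pairing (\<lambda>x. h x + k x) q = pairing h q + pairing k q"
    "pairing (\<lambda>x. h x - k x) q = pairing h q - pairing k q"
    by (subst (1 2 3) pairing_superset[OF fin];
        auto simp: algebra_simps sum.distrib sum_subtractf)+
qed

lemma
  assumes "a \<noteq> 0"
  shows fin_supp_affine: "fin_supp (\<lambda>x. h (a * x + b)) \<longleftrightarrow> fin_supp h"
    and pairing_affine: "pairing (\<lambda>x. h (a * x + b)) (pcompose q [:b, a:]) = pairing h q"
proof -
  let ?g = "\<lambda>x. a * x + b"
  have "bij_betw ?g {x. h (?g x) \<noteq> 0} {y. h y \<noteq> 0}"
    by (rule bij_betw_byWitness[of _ "\<lambda>y. (y - b) / a"]) (use assms in auto)
  then show "fin_supp (\<lambda>x. h (a * x + b)) \<longleftrightarrow> fin_supp h"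
    unfolding fin_supp_def by (rule bij_betw_finite)
  show "pairing (\<lambda>x. h (a * x + b)) (pcompose q [:b, a:]) = pairing h q"
    unfolding pairing_def
    by (rule sum.reindex_bij_witness[of _ "\<lambda>y. (y - b) / a" ?g])
      (use assms in \<open>auto simp: poly_pcompose mult.commute add.commute\<close>)
qed

lemma fin_supp_shift: "fin_supp (\<lambda>x. h (x - \<sigma>)) \<longleftrightarrow> fin_supp h"
  using fin_supp_affine[of 1 h "- \<sigma>"] by simp

lemma pairing_shift: "pairing (\<lambda>x. h (x - \<sigma>)) q = pairing h (pcompose q [:\<sigma>, 1:])"
proof -
  have "pcompose (pcompose q [:\<sigma>, 1:]) [:- \<sigma>, 1:] = q"
    by (simp add: pcompose_assoc [symmetric] pcompose_pCons)
  then show ?thesis using pairing_affine[of 1 h "- \<sigma>" "pcompose q [:\<sigma>, 1:]"] by simp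
qed

text \<open>Summation by parts; finite support of \<open>h\<close> itself allows the sum to be split
  and shifted.\<close>

lemma pairing_back_diff:
  assumes "fin_supp h"
  shows "pairing (back_diff \<sigma> h) q = pairing h (poly_diff \<sigma> q)"
  using pairing_diff_left[of "\<lambda>x. h (x - \<sigma>)" h q] assms
  by (simp add: back_diff_def[abs_def] fin_supp_shift pairing_shift poly_diff_def pairing_right_linear)

text \<open>Both sides are the pairing of \<open>r\<close> with the mixed second difference of
  \<open>f\<close>. Only the first differences need finite support, so this applies to
  colourings.\<close>

lemma pairing_back_diff_commute:
  assumes "fin_supp (back_diff \<sigma> f)" "fin_supp (back_diff \<tau> f)"
  shows "pairing (back_diff \<tau> f) (poly_diff \<sigma> r) = pairing (back_diff \<sigma> f) (poly_diff \<tau> r)"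
proof -
  have "back_diff \<sigma> (back_diff \<tau> f) = back_diff \<tau> (back_diff \<sigma> f)"
    by (simp add: back_diff_def fun_eq_iff algebra_simps)
  then show ?thesis using assms by (metis pairing_back_diff)
qed

text \<open>The linear part of a symmetry of \<open>f\<close> carries the period
  \<open>\<tau>\<close> to \<open>a * \<tau>\<close>.\<close>

lemma
  assumes "a \<noteq> 0" and sym: "\<forall>x. f (a * x + b) = f x"
  shows fin_supp_back_diff_symmetry: "fin_supp (back_diff (a * \<tau>) f) \<longleftrightarrow> fin_supp (back_diff \<tau> f)"
    and pairing_back_diff_symmetry:
      "pairing (back_diff \<tau> f) (pcompose q [:b, a:]) = pairing (back_diff (a * \<tau>) f) q"
proof -
  have "f (a * x + b - a * \<tau>) = f (x - \<tau>)" for x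
    using spec[OF sym, of "x - \<tau>"] by (simp add: algebra_simps)
  then have "(\<lambda>x. back_diff (a * \<tau>) f (a * x + b)) = back_diff \<tau> f"
    by (simp add: back_diff_def fun_eq_iff sym)
  then show "fin_supp (back_diff (a * \<tau>) f) \<longleftrightarrow> fin_supp (back_diff \<tau> f)"
    "pairing (back_diff \<tau> f) (pcompose q [:b, a:]) = pairing (back_diff (a * \<tau>) f) q"
    using fin_supp_affine[OF assms(1), of "back_diff (a * \<tau>) f" b]
      pairing_affine[OF assms(1), of "back_diff (a * \<tau>) f" b q] by simp_all
qed

section \<open>Flux and moments in the presence of an almost period\<close>

text \<open>Call the pairing with 1 the flux. A symmetry preserves it while replacing
  \<open>\<tau>\<close> by \<open>a * \<tau>\<close>, but it is linear in the period; hence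
  \<open>a = 1\<close>. Then the pairing with \<open>X\<close> shifts by \<open>b\<close> times the
  flux, hence \<open>b = 0\<close>.\<close>

lemma symmetry_trivial_if_flux:
  assumes "\<tau> \<noteq> 0" "fin_supp (back_diff \<tau> f)" "pairing (back_diff \<tau> f) 1 \<noteq> 0"
    and "a \<noteq> 0" "\<forall>x. f (a * x + b) = f x"
  shows "a = 1 \<and> b = 0"
proof -
  let ?D = "back_diff \<tau> f"
  have D': "fin_supp (back_diff (a * \<tau>) f)"
    using assms fin_supp_back_diff_symmetry by blast
  have d: "poly_diff \<sigma> [:0, 1:] = smult \<sigma> 1" for \<sigma>
    by (simp add: poly_diff_def pcompose_pCons one_pCons)
  have "pairing ?D 1 = pairing (back_diff (a * \<tau>) f) 1"
    using pairing_back_diff_symmetry[OF assms(4,5), where q = 1 and \<tau> = \<tau>] by (simp add: pcompose_1)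
  moreover have "(a * \<tau>) * pairing ?D 1 = \<tau> * pairing (back_diff (a * \<tau>) f) 1"
    using pairing_back_diff_commute[OF D' assms(2), of "[:0, 1:]"]
    by (simp only: d pairing_right_linear)
  ultimately have "(a * \<tau>) * pairing ?D 1 = \<tau> * pairing ?D 1" by (simp only:)
  then have a: "a = 1" using assms(1,3) by simp
  have "pcompose [:0, 1:] [:b, 1:] = [:0, 1:] + smult b 1"
    by (simp add: pcompose_pCons one_pCons)
  then have "pairing ?D [:0, 1:] + b * pairing ?D 1 = pairing ?D [:0, 1:]"
    using pairing_back_diff_symmetry[OF assms(4,5), where q = "[:0, 1:]" and \<tau> = \<tau>]
    by (simp only: a mult_1_left pairing_right_linear)
  then show ?thesis using a assms(3) by simp
qed

text \<open>The formal value of \<open>\<Sum>x. f x * poly p x\<close>; the choice of q is immaterial only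
  when \<open>pairing (back_diff \<tau> f) 1 = 0\<close>.\<close>
definition moment :: "complex \<Rightarrow> (complex \<Rightarrow> complex) \<Rightarrow> complex poly \<Rightarrow> complex" where
  "moment \<tau> f p = pairing (back_diff \<tau> f) (SOME q. poly_diff \<tau> q = p)"

text \<open>Two antidifferences of \<open>p\<close> differ by a constant, which contributes a
  multiple of the vanishing flux.\<close>

lemma moment_eq:
  assumes "\<tau> \<noteq> 0" "pairing (back_diff \<tau> f) 1 = 0" "poly_diff \<tau> q = p"
  shows "moment \<tau> f p = pairing (back_diff \<tau> f) q"
proof -
  define q' where "q' = (SOME q. poly_diff \<tau> q = p)"
  have "poly_diff \<tau> q' = p" unfolding q'_def using assms(3) by (rule someI)
  then have "poly_diff \<tau> (q' - q) = 0" using assms(3) by simp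
  then obtain k where "q' - q = [:k:]" using poly_diff_eq_0[OF assms(1)] by blast
  then have "q' = q + smult k 1" by (simp add: one_pCons algebra_simps)
  then show ?thesis
    using assms(2) unfolding moment_def q'_def[symmetric] by (simp only: pairing_right_linear) simp
qed

lemma moment_linear:
  assumes "\<tau> \<noteq> 0" "pairing (back_diff \<tau> f) 1 = 0"
  shows "moment \<tau> f (p + q) = moment \<tau> f p + moment \<tau> f q"
    and "moment \<tau> f (smult k p) = k * moment \<tau> f p"
proof -
  obtain P where P: "poly_diff \<tau> P = p" using poly_diff_surj[OF assms(1)] .
  obtain Q where Q: "poly_diff \<tau> Q = q" using poly_diff_surj[OF assms(1)] .
  show "moment \<tau> f (p + q) = moment \<tau> f p + moment \<tau> f q"
    "moment \<tau> f (smult k p) = k * moment \<tau> f p"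
    using moment_eq[OF assms P] moment_eq[OF assms Q] moment_eq[OF assms, of "P + Q" "p + q"]
      moment_eq[OF assms, of "smult k P" "smult k p"] P Q by (simp_all add: pairing_right_linear)
qed

text \<open>Substituting the symmetry turns the period \<open>\<tau>\<close> into
  \<open>a * \<tau>\<close>; the point is that both periods yield the same moment.\<close>

lemma moment_symmetry:
  assumes "\<tau> \<noteq> 0" "fin_supp (back_diff \<tau> f)" "pairing (back_diff \<tau> f) 1 = 0"
    and "a \<noteq> 0" "\<forall>x. f (a * x + b) = f x"
  shows "moment \<tau> f (pcompose p [:b, a:]) = moment \<tau> f p"
proof -
  let ?\<tau> = "a * \<tau>"
  have D': "fin_supp (back_diff ?\<tau> f)"
    using assms fin_supp_back_diff_symmetry by blast
  \<comment> \<open>A common second antidifference r of p links the moments computed with \<tau> and with a \<tau>.\<close>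
  obtain q where q: "poly_diff \<tau> q = p" using poly_diff_surj[OF assms(1)] .
  have "?\<tau> \<noteq> 0" using assms by simp
  then obtain r where r: "poly_diff ?\<tau> r = q" using poly_diff_surj by blast
  have comm: "poly_diff ?\<tau> (poly_diff \<tau> r) = p"
    unfolding q[symmetric] r[symmetric] by (intro poly_ext) (simp add: algebra_simps)
  have "poly_diff \<tau> (pcompose (poly_diff \<tau> r) [:b, a:]) = pcompose p [:b, a:]"
    unfolding comm[symmetric] by (intro poly_ext) (simp add: poly_pcompose algebra_simps)
  then have "moment \<tau> f (pcompose p [:b, a:])
      = pairing (back_diff \<tau> f) (pcompose (poly_diff \<tau> r) [:b, a:])"
    by (rule moment_eq[OF assms(1,3)])
  also have "\<dots> = pairing (back_diff ?\<tau> f) (poly_diff \<tau> r)"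
    by (rule pairing_back_diff_symmetry[OF assms(4,5)])
  also have "\<dots> = pairing (back_diff \<tau> f) (poly_diff ?\<tau> r)"
    by (rule pairing_back_diff_commute[OF assms(2) D'])
  also have "\<dots> = moment \<tau> f p"
    unfolding r using moment_eq[OF assms(1,3) q] by simp
  finally show ?thesis .
qed

text \<open>The indicator of \<open>S\<close> has finite support, so summation by parts applies to
  it, although it need not apply to \<open>f\<close>.\<close>

lemma
  assumes "finite S" "fin_supp (back_diff \<tau> f)"
  shows fin_supp_back_diff_add_points: "fin_supp (back_diff \<tau> (\<lambda>x. f x + of_bool (x \<in> S)))"
    and pairing_back_diff_add_points:
      "pairing (back_diff \<tau> (\<lambda>x. f x + of_bool (x \<in> S))) q
         = pairing (back_diff \<tau> f) q + (\<Sum>x\<in>S. poly (poly_diff \<tau> q) x)"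
proof -
  let ?i = "\<lambda>x. of_bool (x \<in> S) :: complex"
  have i: "fin_supp ?i" using assms(1) by (simp add: fin_supp_def)
  have di: "fin_supp (back_diff \<tau> ?i)"
    unfolding back_diff_def[abs_def] using i
    by (intro fin_supp_diff) (simp_all only: fin_supp_shift[of ?i])
  have eq: "back_diff \<tau> (\<lambda>x. f x + ?i x) = (\<lambda>x. back_diff \<tau> f x + back_diff \<tau> ?i x)"
    by (simp add: back_diff_def fun_eq_iff)
  show "fin_supp (back_diff \<tau> (\<lambda>x. f x + ?i x))"
    unfolding eq by (rule fin_supp_add[OF assms(2) di])
  have "pairing ?i p = (\<Sum>x\<in>S. poly p x)" for p
    by (subst pairing_superset[OF assms(1)]) (auto intro!: sum.cong)
  then show "pairing (back_diff \<tau> (\<lambda>x. f x + ?i x)) q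
      = pairing (back_diff \<tau> f) q + (\<Sum>x\<in>S. poly (poly_diff \<tau> q) x)"
    unfolding eq pairing_add_left[OF assms(2) di] pairing_back_diff[OF i] by simp
qed

lemma moment_add_points:
  assumes "finite S" "fin_supp (back_diff \<tau> f)" "\<tau> \<noteq> 0" "pairing (back_diff \<tau> f) 1 = 0"
  shows "moment \<tau> (\<lambda>x. f x + of_bool (x \<in> S)) p = moment \<tau> f p + (\<Sum>x\<in>S. poly p x)"
proof -
  obtain q where q: "poly_diff \<tau> q = p" using poly_diff_surj[OF assms(3)] .
  have "pairing (back_diff \<tau> (\<lambda>x. f x + of_bool (x \<in> S))) 1 = 0"
    by (simp add: pairing_back_diff_add_points[OF assms(1,2)] assms(4))
  then show ?thesis
    using q by (simp add: moment_eq[OF assms(3) _ q] assms(4) pairing_back_diff_add_points[OF assms(1,2)])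
qed

section \<open>Central moments under symmetries and recolouring\<close>

text \<open>The symmetry fixes the centroid \<open>e = M 1 / M 0\<close>, so it multiplies
  \<open>(X - e)^n\<close> by \<open>a^n\<close>, and the n-th central moment vanishes unless
  \<open>a^n = 1\<close>. The two equations are the cases n = 2 and n = 3 with denominators
  cleared.\<close>

lemma symmetry_central_moments:
  fixes f \<tau>
  defines "M \<equiv> \<lambda>n. moment \<tau> f (monom 1 n)"
  assumes "\<tau> \<noteq> 0" "fin_supp (back_diff \<tau> f)" "pairing (back_diff \<tau> f) 1 = 0"
    and "a \<noteq> 0" "\<forall>x. f (a * x + b) = f x" "M 0 \<noteq> 0" "\<not> (a = 1 \<and> b = 0)"
  shows "M 2 * M 0 = (M 1)\<^sup>2 \<or> M 3 * (M 0)\<^sup>2 - 3 * M 2 * M 1 * M 0 + 2 * M 1 ^ 3 = 0"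
proof -
  let ?L = "moment \<tau> f"
  have L: "?L [:c0, c1, c2, c3:] = c0 * M 0 + c1 * M 1 + c2 * M 2 + c3 * M 3" for c0 c1 c2 c3
  proof -
    have "[:c0, c1, c2, c3:]
        = smult c0 (monom 1 0) + smult c1 (monom 1 1) + smult c2 (monom 1 2) + smult c3 (monom 1 3)"
      by (intro poly_ext) (simp add: poly_monom algebra_simps power2_eq_square power3_eq_cube)
    then show ?thesis unfolding M_def by (simp only: moment_linear[OF assms(2,4)])
  qed
  note inv = moment_symmetry[OF assms(2-6)]
  have "b * M 0 + a * M 1 = M 1"
    using inv[of "[:0, 1:]"] L[of b a 0 0] L[of 0 1 0 0] by (simp add: pcompose_pCons)
  define e where "e = M 1 / M 0"
  have M1: "M 1 = e * M 0" using assms(7) by (simp add: e_def)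
  have "(b + a * e) * M 0 = e * M 0"
    using \<open>b * M 0 + a * M 1 = M 1\<close> unfolding M1 by (simp add: algebra_simps)
  then have "b + a * e = e" using assms(7) by (simp only: mult_cancel_right) simp
  then have b: "b = e - a * e" by (simp add: algebra_simps)
  then have a1: "a \<noteq> 1" using assms(8) by auto
  \<comment> \<open>The coefficient list is that of \<open>(X - e)^2\<close>; below, that of
    \<open>(X - e)^3\<close>.\<close>
  have L2: "?L [:e\<^sup>2, - 2 * e, 1:] = a\<^sup>2 * ?L [:e\<^sup>2, - 2 * e, 1:]"
  proof -
    have "pcompose [:e\<^sup>2, - 2 * e, 1:] [:b, a:] = smult (a\<^sup>2) [:e\<^sup>2, - 2 * e, 1:]"
      unfolding b by (intro poly_ext) (simp add: poly_pcompose, algebra)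
    then show ?thesis
      using inv[of "[:e\<^sup>2, - 2 * e, 1:]"] by (simp only: moment_linear[OF assms(2,4)])
  qed
  have L3: "?L [:- (e ^ 3), 3 * e\<^sup>2, - 3 * e, 1:] = a ^ 3 * ?L [:- (e ^ 3), 3 * e\<^sup>2, - 3 * e, 1:]"
  proof -
    have "pcompose [:- (e ^ 3), 3 * e\<^sup>2, - 3 * e, 1:] [:b, a:] = smult (a ^ 3) [:- (e ^ 3), 3 * e\<^sup>2, - 3 * e, 1:]"
      unfolding b by (intro poly_ext) (simp add: poly_pcompose, algebra)
    then show ?thesis
      using inv[of "[:- (e ^ 3), 3 * e\<^sup>2, - 3 * e, 1:]"] by (simp only: moment_linear[OF assms(2,4)])
  qed
  show ?thesis
  proof (cases "a\<^sup>2 = 1")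
    case True
    then have "a = - 1" using a1 by (simp add: power2_eq_1_iff)
    then have "?L [:- (e ^ 3), 3 * e\<^sup>2, - 3 * e, 1:] = 0"
      using L3 by simp
    then have "M 3 - 3 * e * M 2 + 3 * e\<^sup>2 * M 1 - e ^ 3 * M 0 = 0"
      unfolding L by (simp add: algebra_simps)
    then show ?thesis unfolding M1 by algebra
  next
    case False
    then have "?L [:e\<^sup>2, - 2 * e, 1:] = 0" using L2 by simp
    then have "M 2 - 2 * e * M 1 + e\<^sup>2 * M 0 = 0"
      using L[of "e\<^sup>2" "- 2 * e" 1 0] by (simp add: algebra_simps)
    then show ?thesis unfolding M1 by algebra
  qed
qed

text \<open>Here \<open>m0\<close> already counts the last recoloured point \<open>w\<close>, while
  \<open>m1\<close>, \<open>m2\<close>, \<open>m3\<close> do not. As polynomials in \<open>w\<close>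
  the relations have leading coefficients \<open>m0 - 1\<close> and
  \<open>(m0 - 1) * (m0 - 2)\<close>, so together they have at most five roots.\<close>

lemma avoid_moment_relations:
  fixes m0 m1 m2 m3 :: complex and W :: "complex set"
  assumes "finite W" "card W \<ge> 6" "m0 \<noteq> 0" "m0 \<noteq> 1" "m0 \<noteq> 2"
  obtains w where "w \<in> W" "(m2 + w\<^sup>2) * m0 \<noteq> (m1 + w)\<^sup>2"
    "(m3 + w ^ 3) * m0\<^sup>2 - 3 * (m2 + w\<^sup>2) * (m1 + w) * m0 + 2 * (m1 + w) ^ 3 \<noteq> 0"
proof -
  define p where "p = [:m2 * m0 - m1\<^sup>2, - 2 * m1, m0 - 1:]"
  define q where "q = [:m3 * m0\<^sup>2 - 3 * m2 * m1 * m0 + 2 * m1 ^ 3, 6 * m1\<^sup>2 - 3 * m2 * m0,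
      6 * m1 - 3 * m1 * m0, (m0 - 1) * (m0 - 2):]"
  have nz: "p \<noteq> 0" "q \<noteq> 0" using assms by (auto simp: p_def q_def)
  have "degree p \<le> 2" "degree q \<le> 3" by (simp_all add: p_def q_def)
  then have "degree (p * q) \<le> 5" using nz by (simp add: degree_mult_eq)
  then have "card {x. poly (p * q) x = 0} \<le> 5"
    using card_poly_roots_bound[of "p * q"] nz by simp
  moreover have "finite {x. poly (p * q) x = 0}" using poly_roots_finite[of "p * q"] nz by simp
  ultimately have "\<not> W \<subseteq> {x. poly (p * q) x = 0}"
    using assms(2) card_mono[of "{x. poly (p * q) x = 0}" W] by linarith
  then obtain w where w: "w \<in> W" "poly p w \<noteq> 0" "poly q w \<noteq> 0" by auto
  have "poly p w = (m2 + w\<^sup>2) * m0 - (m1 + w)\<^sup>2"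
    unfolding p_def by simp algebra
  moreover have "poly q w = (m3 + w ^ 3) * m0\<^sup>2 - 3 * (m2 + w\<^sup>2) * (m1 + w) * m0 + 2 * (m1 + w) ^ 3"
    unfolding q_def by simp algebra
  ultimately show ?thesis using that[OF w(1)] w by simp
qed

section \<open>Rigid extensions of colourings of the complex plane\<close>

text \<open>This ranges over all orientation-preserving similarities; rigid motions are those with
  \<open>a\<close> of modulus 1.\<close>

definition affinely_rigid :: "(complex \<Rightarrow> bool) \<Rightarrow> bool" where
  "affinely_rigid c \<longleftrightarrow> (\<forall>a b. a \<noteq> 0 \<and> (\<forall>z. c (a * z + b) = c z) \<longrightarrow> a = 1 \<and> b = 0)"

lemma almost_periodic_extension:
  fixes c :: "complex \<Rightarrow> bool"
  assumes "finite W" "card W \<ge> 9" "\<tau> \<noteq> 0" "finite {z. c (z + \<tau>) \<noteq> c z}"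
  obtains c' where "\<And>x. x \<notin> W \<Longrightarrow> c' x = c x" "affinely_rigid c'"
proof -
  \<comment> \<open>All of \<open>W\<close> starts with value 0, so colouring \<open>S\<close> adds
    exactly the indicator of \<open>S\<close>.\<close>
  define f :: "complex \<Rightarrow> complex" where "f x = of_bool (c x \<and> x \<notin> W)" for x
  define col where "col S x = (x \<in> S \<or> c x \<and> x \<notin> W)" for S x
  have col_f: "(of_bool (col S x) :: complex) = f x + of_bool (x \<in> S)" if "S \<subseteq> W" for S x
    using that by (auto simp: col_def f_def)
  have col_ext: "col S x = c x" if "S \<subseteq> W" "x \<notin> W" for S x using that by (auto simp: col_def)
  have "{x. back_diff \<tau> f x \<noteq> 0} \<subseteq> (\<lambda>z. z + \<tau>) ` {z. c (z + \<tau>) \<noteq> c z} \<union> W \<union> (\<lambda>z. z + \<tau>) ` W"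
  proof
    fix x assume "x \<in> {x. back_diff \<tau> f x \<noteq> 0}"
    then have "x \<in> W \<or> x - \<tau> \<in> W \<or> c (x - \<tau> + \<tau>) \<noteq> c (x - \<tau>)"
      by (auto simp: back_diff_def f_def split: if_splits)
    moreover have "x = (x - \<tau>) + \<tau>" by simp
    ultimately show "x \<in> (\<lambda>z. z + \<tau>) ` {z. c (z + \<tau>) \<noteq> c z} \<union> W \<union> (\<lambda>z. z + \<tau>) ` W"
      by blast
  qed
  then have fin: "fin_supp (back_diff \<tau> f)"
    unfolding fin_supp_def using assms by (auto elim!: finite_subset)
  have rigid: "affinely_rigid (col S)"
    if S: "S \<subseteq> W" and triv: "\<And>a b. a \<noteq> 0 \<Longrightarrow>
      \<forall>x. f (a * x + b) + of_bool (a * x + b \<in> S) = f x + of_bool (x \<in> S) \<Longrightarrow> a = 1 \<and> b = 0" for S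
    unfolding affinely_rigid_def
  proof (intro allI impI)
    fix a b assume ab: "a \<noteq> 0 \<and> (\<forall>z. col S (a * z + b) = col S z)"
    then have "\<forall>x. f (a * x + b) + of_bool (a * x + b \<in> S) = f x + of_bool (x \<in> S)"
      unfolding col_f[OF S, symmetric] by simp
    then show "a = 1 \<and> b = 0" using triv ab by blast
  qed
  have "\<exists>S \<subseteq> W. affinely_rigid (col S)"
  proof (cases "pairing (back_diff \<tau> f) 1 = 0")
    case False
    have "affinely_rigid (col {})"
      by (rule rigid) (use symmetry_trivial_if_flux[OF assms(3) fin False] in auto)
    then show ?thesis by blast
  next
    case True
    define M where "M n = moment \<tau> f (monom 1 n)" for n
    \<comment> \<open>The summand 1 anticipates the last point \<open>w\<close>. If the value lies
      in {0, 1, 2}, three extra points move it into {3, 4, 5}.\<close>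
    have "\<exists>S0 \<subseteq> W. card S0 \<le> 3 \<and> M 0 + of_nat (card S0) + 1 \<notin> {0, 1, 2}"
    proof (cases "M 0 + 1 \<in> {0, 1, 2}")
      case False
      then show ?thesis by (intro exI[of _ "{}"]) simp
    next
      case in012: True
      obtain S0 where "S0 \<subseteq> W" "card S0 = 3"
        using assms(2) obtain_subset_with_card_n[of 3 W] by auto
      moreover have "M 0 + 3 + 1 \<notin> {0, 1, 2}"
      proof -
        have "M 0 + 3 + 1 = (M 0 + 1) + 3" by simp
        then show ?thesis using in012 by (elim insertE) (simp_all only:, simp_all)
      qed
      ultimately show ?thesis by (intro exI[of _ S0]) simp
    qed
    then obtain S0 where S0: "S0 \<subseteq> W" "card S0 \<le> 3"
      and N: "M 0 + of_nat (card S0) + 1 \<notin> {0, 1, 2}" by blast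
    have finS0: "finite S0" using S0 assms(1) finite_subset by blast
    have "finite (W - S0)" "card (W - S0) \<ge> 6"
      using S0 assms finS0 by (simp_all add: card_Diff_subset)
    \<comment> \<open>These are the moments after adding \<open>S0\<close>; adding \<open>w\<close>
      makes the zeroth one \<open>m 0 + 1\<close>.\<close>
    define m where "m n = M n + (\<Sum>x\<in>S0. x ^ n)" for n
    have "m 0 + 1 \<noteq> 0" "m 0 + 1 \<noteq> 1" "m 0 + 1 \<noteq> 2" using N by (auto simp: m_def)
    then obtain w where w: "w \<in> W - S0" "(m 2 + w\<^sup>2) * (m 0 + 1) \<noteq> (m 1 + w)\<^sup>2"
      "(m 3 + w ^ 3) * (m 0 + 1)\<^sup>2 - 3 * (m 2 + w\<^sup>2) * (m 1 + w) * (m 0 + 1) + 2 * (m 1 + w) ^ 3 \<noteq> 0"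
      using avoid_moment_relations[OF \<open>finite (W - S0)\<close> \<open>card (W - S0) \<ge> 6\<close>, of "m 0 + 1" "m 2" "m 1" "m 3"]
      by blast
    define S where "S = insert w S0"
    have finS: "finite S" and SW: "S \<subseteq> W" using finS0 w S0 by (auto simp: S_def)
    define F where "F x = f x + of_bool (x \<in> S)" for x
    have F: "F = (\<lambda>x. f x + of_bool (x \<in> S))" by (simp add: F_def fun_eq_iff)
    have mom: "moment \<tau> F (monom 1 n) = m n + w ^ n" for n
      unfolding F moment_add_points[OF finS fin assms(3) True]
      using w(1) finS0 by (simp add: S_def m_def M_def poly_monom)
    have finF: "fin_supp (back_diff \<tau> F)"
      unfolding F by (rule fin_supp_back_diff_add_points[OF finS fin])
    have fluxF: "pairing (back_diff \<tau> F) 1 = 0"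
      unfolding F by (simp add: pairing_back_diff_add_points[OF finS fin] True)
    have "affinely_rigid (col S)"
    proof (rule rigid[OF SW])
      fix a b :: complex assume a: "a \<noteq> 0"
        and "\<forall>x. f (a * x + b) + of_bool (a * x + b \<in> S) = f x + of_bool (x \<in> S)"
      then have sym: "\<forall>x. F (a * x + b) = F x" by (simp add: F_def)
      show "a = 1 \<and> b = 0"
        using symmetry_central_moments[OF assms(3) finF fluxF a sym] w(2,3) \<open>m 0 + 1 \<noteq> 0\<close>
        unfolding mom by auto
    qed
    then show ?thesis using SW by blast
  qed
  then show ?thesis using that col_ext by blast
qed

lemma rigid_extension:
  fixes c :: "complex \<Rightarrow> bool"
  assumes "finite W" "card W \<ge> 9"
  obtains c' where "\<And>x. x \<notin> W \<Longrightarrow> c' x = c x" "affinely_rigid c'"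
proof -
  have "\<exists>c'. (\<forall>x. x \<notin> W \<longrightarrow> c' x = c x) \<and> affinely_rigid c'"
  proof (rule ccontr)
    assume none: "\<not> ?thesis"
    \<comment> \<open>An almost period of any extension \<open>e\<close> of the precoloring would
      yield a rigid extension. In particular no nontrivial symmetry of an extension is a
      translation.\<close>
    have no_period: "\<tau> = 0" if e: "\<And>x. x \<notin> W \<Longrightarrow> e x = c x" "finite {z. e (z + \<tau>) \<noteq> e z}" for e \<tau>
    proof (rule ccontr)
      assume "\<tau> \<noteq> 0"
      then obtain c' where "\<And>x. x \<notin> W \<Longrightarrow> c' x = e x" "affinely_rigid c'"
        using almost_periodic_extension[OF assms _ e(2)] by blast
      then show False using none e(1) by auto
    qed
    have "\<not> affinely_rigid c" using none by blast
    then obtain a b where a: "a \<noteq> 0" "\<not> (a = 1 \<and> b = 0)" and sym: "\<And>z. c (a * z + b) = c z"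
      unfolding affinely_rigid_def by blast
    have "b = 0" if "a = 1"
      using no_period[of c b] sym that by (simp add: add.commute)
    then have a1: "a \<noteq> 1" using a by blast
    \<comment> \<open>\<open>b / (1 - a)\<close> is the fixed point of the first symmetry.\<close>
    have "\<not> W \<subseteq> {b / (1 - a)}" using assms card_mono[of "{b / (1 - a)}" W] by auto
    then obtain w where w: "w \<in> W" "w \<noteq> b / (1 - a)" by blast
    define c1 where "c1 = c(w := \<not> c w)"
    have c1: "c1 x = c x" if "x \<notin> W" for x using that w by (auto simp: c1_def)
    have "\<not> affinely_rigid c1" using none c1 by blast
    then obtain a' b' where a': "a' \<noteq> 0" "\<not> (a' = 1 \<and> b' = 0)" and sym': "\<And>z. c1 (a' * z + b') = c1 z"
      unfolding affinely_rigid_def by blast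
    have "b' = 0" if "a' = 1"
      using no_period[of c1 b'] c1 sym' that by (simp add: add.commute)
    then have a1': "a' \<noteq> 1" using a' by blast
    \<comment> \<open>Write g and g' for the two symmetries. Both g g' and g' g have linear part
      \<open>a * a'\<close>, so they differ by the translation \<open>\<tau>\<close>;
      \<open>h\<close> is the inverse of g' g.\<close>
    define \<tau> where "\<tau> = (a * b' + b) - (a' * b + b')"
    define h where "h y = (y - (a' * b + b')) / (a * a')" for y
    have h: "a' * (a * h y + b) + b' = y" "a * (a' * h y + b') + b = y + \<tau>" for y
      using a(1) a'(1) by (simp_all add: h_def \<tau>_def field_simps)
    \<comment> \<open>\<open>c\<close> and \<open>c1\<close> agree off \<open>w\<close>, so the
      chain can break only when one of four points equals \<open>w\<close>.\<close>
    have "c (y + \<tau>) = c y" if "h y \<noteq> w" "a' * h y + b' \<noteq> w" "a * h y + b \<noteq> w" "y \<noteq> w" for y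
    proof -
      have "c (y + \<tau>) = c (a' * h y + b')" using sym[of "a' * h y + b'"] h(2) by simp
      also have "\<dots> = c (h y)" using sym'[of "h y"] that by (simp add: c1_def)
      also have "\<dots> = c (a * h y + b)" using sym by simp
      also have "\<dots> = c y" using sym'[of "a * h y + b"] that h(1) by (simp add: c1_def)
      finally show ?thesis .
    qed
    then have "{y. c (y + \<tau>) \<noteq> c y} \<subseteq>
        {y. h y = w} \<union> {y. a' * h y + b' = w} \<union> {y. a * h y + b = w} \<union> {w}" by blast
    moreover have "finite {y. h y = w}"
      by (rule finite_subset[of _ "{a' * (a * w + b) + b'}"]) (use h(1) in auto)
    moreover have "finite {y. a' * h y + b' = w}"
      by (rule finite_subset[of _ "{a * w + b - \<tau>}"]) (use h(2) in \<open>auto simp: algebra_simps\<close>)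
    moreover have "finite {y. a * h y + b = w}"
      by (rule finite_subset[of _ "{a' * w + b'}"]) (use h(1) in auto)
    ultimately have "finite {y. c (y + \<tau>) \<noteq> c y}"
      by (meson finite.emptyI finite.insertI finite_UnI finite_subset)
    then have "\<tau> = 0" using no_period[of c \<tau>] by simp
    then have comm: "a * (a' * z + b') + b = a' * (a * z + b) + b'" for z
      unfolding \<tau>_def by (simp add: algebra_simps)
    have mv: "a * w + b \<noteq> w" using w(2) a1 by (auto simp: field_simps)
    \<comment> \<open>If g' fixed \<open>w\<close>, commutation would make it fix g(w) as well, two
      distinct points, although \<open>a' \<noteq> 1\<close>.\<close>
    have mv': "a' * w + b' \<noteq> w"
    proof
      assume "a' * w + b' = w"
      then have "a * w + b = a' * (a * w + b) + b'" "w = a' * w + b'"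
        using comm[of w] by simp_all
      then have "a * w + b - w = a' * (a * w + b - w)"
        by (metis add_diff_cancel_right right_diff_distrib)
      then show False using a1' mv by simp
    qed
    \<comment> \<open>The point g g'(w) = g' g(w) gets colour \<open>c w\<close> under
      \<open>c1\<close> and the opposite under \<open>c\<close>. Since these differ only at
      \<open>w\<close>, the point is \<open>w\<close>, contradicting both values.\<close>
    have 1: "c (a' * w + b') = (\<not> c w)" using sym'[of w] mv' by (simp add: c1_def)
    have "c1 (a' * (a * w + b) + b') = c w" using sym'[of "a * w + b"] mv sym[of w] by (simp add: c1_def)
    moreover have "c (a' * (a * w + b) + b') = (\<not> c w)" using sym[of "a' * w + b'"] comm[of w] 1 by simp
    ultimately show False by (auto simp: c1_def split: if_splits)
  qed
  then show ?thesis using that by blast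
qed

section \<open>Transfer to rigid motions of the real plane\<close>

definition to_complex :: "real^2 \<Rightarrow> complex" where
  "to_complex v = Complex (v $ 1) (v $ 2)"

lemma bij_to_complex: "bij to_complex"
proof (rule bijI)
  show "inj to_complex" by (auto simp: inj_def to_complex_def vec_eq_iff forall_2)
  show "surj to_complex"
  proof (rule surjI)
    fix z show "to_complex (vector [Re z, Im z]) = z" by (simp add: to_complex_def)
  qed
qed

text \<open>Orthonormal columns and determinant 1 force the second column to be the first turned by
  a right angle, so the matrix is multiplication by a complex number.\<close>

lemma SE2_complex_affine:
  assumes "g \<in> SE2"
  obtains a b where "a \<noteq> 0" "\<And>v. to_complex (g v) = a * to_complex v + b"
proof -
  obtain A :: "real^2^2" and t where g: "g = (\<lambda>v. A *v v + t)" and "rotation_matrix A"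
    using assms by (auto simp: SE2_def)
  then have "transpose A ** A = mat 1" "A ** transpose A = mat 1" and d: "det A = 1"
    by (auto simp: rotation_matrix_def orthogonal_matrix_def)
  then have o: "A$1$1 * A$1$1 + A$2$1 * A$2$1 = 1" "A$1$2 * A$1$2 + A$2$2 * A$2$2 = 1"
      "A$1$1 * A$1$2 + A$2$1 * A$2$2 = 0"
    by (simp_all add: vec_eq_iff forall_2 matrix_matrix_mult_def transpose_def mat_def sum_2)
  have d2: "A$1$1 * A$2$2 - A$1$2 * A$2$1 = 1" using d by (simp add: det_2)
  have "A$2$2 = A$1$1" "A$1$2 = - A$2$1" using o d2 by algebra+
  then have "to_complex (g v) = Complex (A$1$1) (A$2$1) * to_complex v + to_complex t" for v
    by (simp add: g to_complex_def complex_eq_iff matrix_vector_mult_def sum_2 algebra_simps)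
  moreover have "Complex (A$1$1) (A$2$1) \<noteq> 0" using o(1) by (auto simp: complex_eq_iff)
  ultimately show ?thesis using that by blast
qed

lemma ext_D_good_SE2: "ext_D_good (UNIV :: (real^2) set) SE2 9"
  unfolding ext_D_good_def prop_P_def
proof (intro allI impI)
  fix W :: "(real^2) set" and c :: "real^2 \<Rightarrow> bool"
  assume "W \<subseteq> UNIV \<and> card_at_least W 9 \<and> trivial_pointwise_stabilizer UNIV SE2 W"
  \<comment> \<open>Only nine points of \<open>W\<close> get recoloured; the rest of
    \<open>W\<close> keeps the values of \<open>c\<close>, which also covers infinite
    \<open>W\<close>.\<close>
  then obtain V where V: "V \<subseteq> W" "finite V" "card V = 9"
    unfolding card_at_least_def
    by (metis infinite_arbitrarily_large obtain_subset_with_card_n)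
  have inj: "inj to_complex" and surj: "surj to_complex"
    using bij_to_complex by (simp_all add: bij_def)
  have "finite (to_complex ` V)" "card (to_complex ` V) \<ge> 9"
    using V inj by (simp_all add: card_image inj_on_subset)
  then obtain e where e: "\<And>z. z \<notin> to_complex ` V \<Longrightarrow> e z = c (inv to_complex z)"
    and rigid: "affinely_rigid e"
    by (rule rigid_extension[where c = "\<lambda>z. c (inv to_complex z)"]) blast
  have "e (to_complex x) = c x" if "x \<notin> W" for x
    using e[of "to_complex x"] that V inj by (auto simp: inj_image_mem_iff)
  moreover have "distinguishing UNIV SE2 (\<lambda>x. e (to_complex x))"
    unfolding distinguishing_def
  proof (intro ballI impI)
    fix g x assume g: "g \<in> SE2" and sym: "\<forall>x\<in>UNIV. e (to_complex (g x)) = e (to_complex x)"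
    obtain a b where ab: "a \<noteq> 0" "\<And>v. to_complex (g v) = a * to_complex v + b"
      using SE2_complex_affine[OF g] by blast
    have "e (a * z + b) = e z" for z
      using sym ab(2) surj by (metis UNIV_I surjD)
    then have "a = 1 \<and> b = 0" using rigid ab(1) unfolding affinely_rigid_def by blast
    then show "g x = x" using ab(2)[of x] inj by (simp add: inj_eq)
  qed
  ultimately show "\<exists>c'. (\<forall>x\<in>UNIV - W. c' x = c x) \<and> distinguishing UNIV SE2 c'"
    by (intro exI[of _ "\<lambda>x. e (to_complex x)"]) simp
qed

theorem theorem3p3:
  shows "ext_D (UNIV :: (real^2) set) SE2 < \<infinity>"
  using ext_D_good_SE2 by (auto simp: ext_D_def)

end
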